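(* The ideal $\mathcal{SC}$ is an HL ideal.
   Context: A set $A\subseteq\omega$ is an SC-set if for each $n\in\omega$ the set $\{\{a,b\}\in[A]^2:|a-b|<n\}$ is finite; $\mathcal{SC}$ is the ideal on $\omega$ generated by SC-sets. A tree is an initial subset of $(2^{<\omega},\subseteq)$ without maximal elements, perfect if every node has two incompatible extensions in it; $\mathbf S$ is the set of perfect trees; $p\restriction A=\{s\in p\cap2^n:n\in A\}$. An ideal $\mathcal I$ on $\omega$ is HL if for every $c:2^{<\omega}\to2$ there are $p\in\mathbf S$ and $A\in\mathcal I^+=\mathcal P(\omega)\setminus\mathcal I$ with $c$ constant on $p\restriction A$. *)

theory Defs
  imports Main "HOL-Library.Sublist"
begin

(* An ideal on omega is, as usual, proper and contains all finite sets. *)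
definition ideal_on_nat :: "nat set set \<Rightarrow> bool" where
  "ideal_on_nat I \<longleftrightarrow>
     (\<forall>A. finite A \<longrightarrow> A \<in> I) \<and>
     (\<forall>A B. A \<in> I \<longrightarrow> B \<subseteq> A \<longrightarrow> B \<in> I) \<and>
     (\<forall>A B. A \<in> I \<longrightarrow> B \<in> I \<longrightarrow> A \<union> B \<in> I) \<and>
     UNIV \<notin> I"

(* If no proper ideal contains G, this is the improper ideal UNIV. *)
definition generated_ideal :: "nat set set \<Rightarrow> nat set set" where
  "generated_ideal G = \<Inter> {I. ideal_on_nat I \<and> G \<subseteq> I}"

definition SC_set :: "nat set \<Rightarrow> bool" where
  "SC_set A \<longleftrightarrow>
     (\<forall>n::nat. finite {{a, b} | a b. a \<in> A \<and> b \<in> A \<and> a \<noteq> b \<and> \<bar>int a - int b\<bar> < int n})"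

definition SC :: "nat set set" where
  "SC = generated_ideal {A. SC_set A}"

(* The nodes of the full binary tree are the finite bool lists, and inclusion of finite
   sequences is the prefix order. Trees are required to be nonempty: the empty set would
   otherwise be a perfect tree, and every ideal would be HL. *)
definition is_tree :: "bool list set \<Rightarrow> bool" where
  "is_tree p \<longleftrightarrow>
     p \<noteq> {} \<and>
     (\<forall>t\<in>p. \<forall>s. prefix s t \<longrightarrow> s \<in> p) \<and>
     (\<forall>s\<in>p. \<exists>t\<in>p. strict_prefix s t)"

definition perfect_trees :: "bool list set set" where
  "perfect_trees =
     {p. is_tree p \<and> (\<forall>s\<in>p. \<exists>t\<in>p. \<exists>u\<in>p. prefix s t \<and> prefix s u \<and> t \<parallel> u)}"

definition tree_restrict :: "bool list set \<Rightarrow> nat set \<Rightarrow> bool list set" where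
  "tree_restrict p A = {s \<in> p. length s \<in> A}"

definition HL_ideal :: "nat set set \<Rightarrow> bool" where
  "HL_ideal I \<longleftrightarrow>
     ideal_on_nat I \<and>
     (\<forall>c :: bool list \<Rightarrow> bool. \<exists>p\<in>perfect_trees. \<exists>A. A \<notin> I \<and>
        (\<exists>i. \<forall>s\<in>tree_restrict p A. c s = i))"

end

theory Submission
  imports Defs "HOL-Library.Countable" "HOL-Library.Infinite_Set"
    "HOL-Library.Diagonal_Subsequence"
begin

text \<open>
  A set of levels is \<open>\<S>\<C>\<close>-positive as soon as, for every \<open>k\<close>, it contains infinitely many
  translates of some fixed set with \<open>k\<close> elements. Fix a filter \<open>F\<close> on \<open>\<omega>\<close> deciding the countably
  many relevant sets of levels, and call a finite set \<open>K\<close> of offsets dense in colour \<open>i\<close> above a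
  node \<open>t\<close> if every extension of \<open>t\<close> lies, for \<open>F\<close>-almost all \<open>l\<close>, on a branch with colour \<open>i\<close> at
  all levels in \<open>l + K\<close>. Above every node, each \<open>K\<close> splits into a part dense in one colour and a
  part dense in the other, after extending the node.

  For some colour \<open>i\<close> and node \<open>s\<close>, any finitely many nodes above \<open>s\<close> have extensions sharing a
  set of \<open>k\<close> offsets dense in colour \<open>i\<close>. If this fails for colour \<open>True\<close>, take a failing family
  of least size and a member \<open>u\<close> of it. The other members share arbitrarily large sets dense in
  colour \<open>True\<close>; above \<open>u\<close> each of them has to be dense in colour \<open>False\<close> up to fewer than \<open>k\<close>
  points, which gives the property for \<open>False\<close> above \<open>u\<close>. A fusion then builds the perfect tree.
\<close>

section \<open>Positive sets\<close>

text \<open>A sufficient condition for lying outside \<open>SC\<close>. The sets failing it form a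
  proper ideal, which spares an analysis of finite unions of SC-sets. The offset set may vary with
  \<open>k\<close>.\<close>

definition translate_positive :: "nat set \<Rightarrow> bool" where
  "translate_positive A \<longleftrightarrow>
     (\<forall>k. \<exists>K. finite K \<and> card K = k \<and> infinite {l. \<forall>x\<in>K. l + x \<in> A})"

lemma translate_positive_mono:
  assumes "translate_positive B" "B \<subseteq> A"
  shows "translate_positive A"
  unfolding translate_positive_def
proof
  fix k
  obtain K where K: "finite K" "card K = k" "infinite {l. \<forall>x\<in>K. l + x \<in> B}"
    using assms(1) unfolding translate_positive_def by blast
  have "{l. \<forall>x\<in>K. l + x \<in> B} \<subseteq> {l. \<forall>x\<in>K. l + x \<in> A}"
    using assms(2) by auto
  then show "\<exists>K. finite K \<and> card K = k \<and> infinite {l. \<forall>x\<in>K. l + x \<in> A}"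
    using K infinite_super by blast
qed

lemma translate_positive_UNIV: "translate_positive UNIV"
  unfolding translate_positive_def
proof
  fix k
  show "\<exists>K. finite K \<and> card K = k \<and> infinite {l. \<forall>x\<in>K. l + x \<in> (UNIV :: nat set)}"
    by (rule exI[of _ "{..<k}"]) simp
qed

lemma not_translate_positive_finite:
  assumes "finite A"
  shows "\<not> translate_positive A"
proof
  assume "translate_positive A"
  then obtain K where K: "finite K" "card K = 1" "infinite {l. \<forall>x\<in>K. l + x \<in> A}"
    unfolding translate_positive_def by blast
  obtain a where "K = {a}"
    using K(2) card_1_singletonE by blast
  then have "infinite {l. l + a \<in> A}"
    using K(3) by simp
  moreover have "finite {l. l + a \<in> A}"
    using finite_vimageI[OF assms, of "\<lambda>l. l + a"] by (simp add: vimage_def inj_def)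
  ultimately show False by blast
qed

text \<open>Two offsets suffice: their translates are infinitely many distinct pairs at one fixed
  distance.\<close>

lemma not_translate_positive_SC_set:
  assumes "SC_set A"
  shows "\<not> translate_positive A"
proof
  assume "translate_positive A"
  then obtain K where K: "finite K" "card K = 2" "infinite {l. \<forall>x\<in>K. l + x \<in> A}"
    unfolding translate_positive_def by blast
  obtain a b where ab: "K = {a, b}" "a \<noteq> b"
    using K(2) card_2_iff by metis
  let ?P = "{{x, y} | x y. x \<in> A \<and> y \<in> A \<and> x \<noteq> y \<and> \<bar>int x - int y\<bar> < int (a + b + 1)}"
  have "(\<lambda>l. {l + a, l + b}) ` {l. \<forall>x\<in>K. l + x \<in> A} \<subseteq> ?P"
  proof
    fix z assume "z \<in> (\<lambda>l. {l + a, l + b}) ` {l. \<forall>x\<in>K. l + x \<in> A}"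
    then obtain l where l: "z = {l + a, l + b}" "l + a \<in> A" "l + b \<in> A"
      using ab by auto
    have "\<bar>int (l + a) - int (l + b)\<bar> < int (a + b + 1)" "l + a \<noteq> l + b"
      using ab(2) by auto
    then show "z \<in> ?P" using l by blast
  qed
  moreover have "finite ?P"
    using assms unfolding SC_set_def by blast
  moreover have "inj (\<lambda>l. {l + a, l + b})"
    by (auto simp: inj_def doubleton_eq_iff)
  ultimately show False
    using K(3) by (meson finite_imageD finite_subset inj_on_subset subset_UNIV)
qed

text \<open>Pigeonhole on offsets: if \<open>A\<close> fails at size \<open>m\<close> and
  \<open>B\<close> at size \<open>n\<close>, every translate of an \<open>m + n\<close> element set
  puts \<open>m\<close> points in \<open>A\<close> or \<open>n\<close> points in \<open>B\<close>.
  Only finitely many subsets occur, each for finitely many \<open>l\<close>.\<close>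

lemma translate_positive_Un:
  assumes "translate_positive (A \<union> B)"
  shows "translate_positive A \<or> translate_positive B"
proof (rule ccontr)
  assume "\<not> ?thesis"
  then have neg: "\<not> translate_positive A" "\<not> translate_positive B" by simp_all
  obtain m where m: "\<forall>K. finite K \<and> card K = m \<longrightarrow> finite {l. \<forall>x\<in>K. l + x \<in> A}"
    using neg(1) unfolding translate_positive_def by auto
  obtain n where n: "\<forall>K. finite K \<and> card K = n \<longrightarrow> finite {l. \<forall>x\<in>K. l + x \<in> B}"
    using neg(2) unfolding translate_positive_def by auto
  obtain K where K: "finite K" "card K = m + n" "infinite {l. \<forall>x\<in>K. l + x \<in> A \<union> B}"
    using assms unfolding translate_positive_def by blast
  have "{l. \<forall>x\<in>K. l + x \<in> A \<union> B}
      \<subseteq> (\<Union>L\<in>{L. L \<subseteq> K \<and> card L = m}. {l. \<forall>x\<in>L. l + x \<in> A})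
      \<union> (\<Union>L\<in>{L. L \<subseteq> K \<and> card L = n}. {l. \<forall>x\<in>L. l + x \<in> B})"
  proof
    fix l assume "l \<in> {l. \<forall>x\<in>K. l + x \<in> A \<union> B}"
    then have l: "\<forall>x\<in>K. l + x \<in> A \<union> B" by simp
    define L where "L = {x \<in> K. l + x \<in> A}"
    have L: "L \<subseteq> K" "\<forall>x\<in>L. l + x \<in> A" "\<forall>x\<in>K - L. l + x \<in> B"
      using l by (auto simp: L_def)
    have "card (K - L) = m + n - card L"
      using card_Diff_subset[OF finite_subset[OF L(1) K(1)] L(1)] K(2) by simp
    then have "m \<le> card L \<or> n \<le> card (K - L)"
      by linarith
    then show "l \<in> (\<Union>L\<in>{L. L \<subseteq> K \<and> card L = m}. {l. \<forall>x\<in>L. l + x \<in> A})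
      \<union> (\<Union>L\<in>{L. L \<subseteq> K \<and> card L = n}. {l. \<forall>x\<in>L. l + x \<in> B})"
    proof
      assume "m \<le> card L"
      then obtain L' where L': "L' \<subseteq> L" "card L' = m"
        by (rule obtain_subset_with_card_n)
      then have "L' \<subseteq> K" "\<forall>x\<in>L'. l + x \<in> A" using L(1,2) by auto
      then show ?thesis using L'(2) by (intro UnI1 UN_I[of L']) simp_all
    next
      assume "n \<le> card (K - L)"
      then obtain L' where L': "L' \<subseteq> K - L" "card L' = n"
        by (rule obtain_subset_with_card_n)
      then have "L' \<subseteq> K" "\<forall>x\<in>L'. l + x \<in> B" using L(3) by auto
      then show ?thesis using L'(2) by (intro UnI2 UN_I[of L']) simp_all
    qed
  qed
  moreover have "finite \<dots>"
  proof -
    have "finite {L. L \<subseteq> K \<and> card L = j}" for j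
      using K(1) by simp
    moreover have "finite {l. \<forall>x\<in>L. l + x \<in> A}" if "L \<subseteq> K" "card L = m" for L
      using m that finite_subset[OF that(1) K(1)] by simp
    moreover have "finite {l. \<forall>x\<in>L. l + x \<in> B}" if "L \<subseteq> K" "card L = n" for L
      using n that finite_subset[OF that(1) K(1)] by simp
    ultimately show ?thesis
      by (intro finite_UnI finite_UN_I) simp_all
  qed
  ultimately have "finite {l. \<forall>x\<in>K. l + x \<in> A \<union> B}"
    by (rule finite_subset)
  with K(3) show False by contradiction
qed

lemma ideal_not_translate_positive: "ideal_on_nat {A. \<not> translate_positive A}"
  unfolding ideal_on_nat_def mem_Collect_eq
  using not_translate_positive_finite translate_positive_mono translate_positive_Un
    translate_positive_UNIV by metis

text \<open>The sets that are not translate-positive form one of the ideals in the intersection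
  defining \<open>SC\<close>.\<close>

lemma SC_subset: "SC \<subseteq> {A. \<not> translate_positive A}"
  unfolding SC_def generated_ideal_def
  using ideal_not_translate_positive not_translate_positive_SC_set by blast

text \<open>Properness comes from the proper ideal in \<open>SC_subset\<close>; the closure
  conditions pass to intersections.\<close>

lemma ideal_SC: "ideal_on_nat SC"
proof -
  have "UNIV \<notin> SC"
    using SC_subset translate_positive_UNIV by blast
  moreover have "A \<in> SC" if "finite A" for A
    using that unfolding SC_def generated_ideal_def ideal_on_nat_def by simp
  moreover have "B \<in> SC" if "A \<in> SC" "B \<subseteq> A" for A B
    unfolding SC_def generated_ideal_def
  proof (rule InterI, clarify)
    fix I assume I: "ideal_on_nat I" "Collect SC_set \<subseteq> I"
    then have "A \<in> I" using that(1) unfolding SC_def generated_ideal_def by blast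
    then show "B \<in> I" using I(1) that(2) unfolding ideal_on_nat_def by metis
  qed
  moreover have "A \<union> B \<in> SC" if "A \<in> SC" "B \<in> SC" for A B
    unfolding SC_def generated_ideal_def
  proof (rule InterI, clarify)
    fix I assume I: "ideal_on_nat I" "Collect SC_set \<subseteq> I"
    then have "A \<in> I" "B \<in> I" using that unfolding SC_def generated_ideal_def by blast+
    then show "A \<union> B \<in> I" using I(1) unfolding ideal_on_nat_def by metis
  qed
  ultimately show ?thesis
    unfolding ideal_on_nat_def by metis
qed

section \<open>Dense offset sets\<close>

text \<open>Does the work of an ultrafilter for countably many predicates: a diagonal sequence is
  eventually homogeneous for each of them, and \<open>F\<close> is the filter of sets containing
  almost all its terms.\<close>

lemma deciding_filter_exists:
  fixes P :: "'a::countable \<Rightarrow> nat \<Rightarrow> bool"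
  obtains F where "F \<noteq> bot" "F \<le> sequentially"
    "\<And>a. eventually (P a) F \<or> eventually (\<lambda>l. \<not> P a l) F"
proof -
  define Q where "Q n s \<longleftrightarrow> (\<forall>j::nat. P (from_nat n) (s j)) \<or> (\<forall>j. \<not> P (from_nat n) (s j))"
    for n and s :: "nat \<Rightarrow> nat"
  interpret subseqs Q
  proof
    fix n and s :: "nat \<Rightarrow> nat"
    let ?X = "{j. P (from_nat n) (s j)}"
    have "infinite ?X \<or> infinite (- ?X)"
      using finite_compl infinite_UNIV_nat by blast
    then show "\<exists>r. strict_mono r \<and> Q n (s \<circ> r)"
    proof
      assume "infinite ?X"
      from infinite_enumerate[OF this] show ?thesis by (auto simp: Q_def)
    next
      assume "infinite (- ?X)"
      from infinite_enumerate[OF this] show ?thesis by (auto simp: Q_def)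
    qed
  qed
  define F where "F = filtermap diagseq sequentially"
  have "eventually (P a) F \<or> eventually (\<lambda>l. \<not> P a l) F" for a
  proof -
    \<comment> \<open>Homogeneity for the predicate with index \<open>to_nat a\<close> is guaranteed
      from position \<open>Suc (to_nat a)\<close> on; the shift does not affect eventual
      truth.\<close>
    have "Q (to_nat a) (diagseq \<circ> ((+) (Suc (to_nat a))))"
      by (rule diagseq_holds) (auto simp: Q_def)
    then have "(\<forall>j. P a (diagseq (j + Suc (to_nat a)))) \<or> (\<forall>j. \<not> P a (diagseq (j + Suc (to_nat a))))"
      by (simp add: Q_def add.commute)
    then show ?thesis
      unfolding F_def eventually_filtermap
      using eventually_sequentially_seg[of "\<lambda>j. P a (diagseq j)" "Suc (to_nat a)"]
        eventually_sequentially_seg[of "\<lambda>j. \<not> P a (diagseq j)" "Suc (to_nat a)"]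
      by auto
  qed
  moreover have "F \<noteq> bot"
    by (simp add: F_def filtermap_bot_iff)
  moreover have "F \<le> sequentially"
    using filterlim_subseq[OF subseq_diagseq] by (simp add: F_def filterlim_def)
  ultimately show ?thesis using that by blast
qed

text \<open>A finite node \<open>b\<close> plays the role of a branch. A full window of consecutive
  levels is recorded, so that one pattern settles both colours at once; pairs of a node and a
  pattern are countable.\<close>

definition has_pattern :: "(bool list \<Rightarrow> bool) \<Rightarrow> bool list \<Rightarrow> bool list \<Rightarrow> nat \<Rightarrow> bool" where
  "has_pattern c t x l \<longleftrightarrow>
     (\<exists>b. prefix t b \<and> l + length x \<le> length b \<and> (\<forall>k<length x. c (take (l + k) b) = x ! k))"

text \<open>Since \<open>take\<close> is total, the length bound is what guarantees a node of
  \<open>b\<close> at level \<open>l + k\<close>.\<close>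

definition realizes :: "(bool list \<Rightarrow> bool) \<Rightarrow> bool \<Rightarrow> bool list \<Rightarrow> nat set \<Rightarrow> nat \<Rightarrow> bool" where
  "realizes c i t K l \<longleftrightarrow>
     (\<exists>b. prefix t b \<and> (\<forall>k\<in>K. l + k \<le> length b \<and> c (take (l + k) b) = i))"

definition dense_offsets ::
  "(bool list \<Rightarrow> bool) \<Rightarrow> nat filter \<Rightarrow> bool \<Rightarrow> bool list \<Rightarrow> nat set \<Rightarrow> bool" where
  "dense_offsets c F i t K \<longleftrightarrow> (\<forall>t'. prefix t t' \<longrightarrow> eventually (realizes c i t' K) F)"

lemma dense_offsets_extend:
  "dense_offsets c F i t K \<Longrightarrow> prefix t t' \<Longrightarrow> dense_offsets c F i t' K"
  unfolding dense_offsets_def using prefix_order.trans by blast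

lemma dense_offsets_subset:
  assumes "dense_offsets c F i t K" "K' \<subseteq> K"
  shows "dense_offsets c F i t K'"
proof -
  have "realizes c i t' K' l" if "realizes c i t' K l" for t' l
    using that assms(2) unfolding realizes_def by blast
  then show ?thesis
    using assms(1) unfolding dense_offsets_def by (blast intro: eventually_mono)
qed

lemma has_pattern_exists: "\<exists>x. length x = n \<and> has_pattern c t x l"
proof -
  define b where "b = t @ replicate (l + n) True"
  let ?x = "map (\<lambda>k. c (take (l + k) b)) [0..<n]"
  have "has_pattern c t ?x l"
    unfolding has_pattern_def by (rule exI[of _ b]) (auto simp: b_def)
  then show ?thesis by (intro exI[of _ ?x]) simp
qed

lemma has_pattern_prefix:
  "has_pattern c t' x l \<Longrightarrow> prefix t t' \<Longrightarrow> has_pattern c t x l"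
  unfolding has_pattern_def using prefix_order.trans by blast

text \<open>The set of patterns of a fixed length that occur above a node for
  \<open>F\<close>-almost all \<open>l\<close> is finite, nonempty and shrinks along extensions, so
  it is constant above some node. Any pattern in the stable set splits the offsets by its two
  values.\<close>

lemma dense_offsets_partition:
  assumes F: "F \<noteq> bot"
    and dec: "\<And>t x. eventually (has_pattern c t x) F \<or> eventually (\<lambda>l. \<not> has_pattern c t x l) F"
    and K: "finite K"
  shows "\<exists>t' K0. prefix t t' \<and> K0 \<subseteq> K \<and> dense_offsets c F True t' K0
    \<and> dense_offsets c F False t' (K - K0)"
proof -
  obtain n where n: "K \<subseteq> {..<n}"
    using K finite_nat_iff_bounded by blast
  define D where "D t = {x. length x = n \<and> eventually (has_pattern c t x) F}" for t
  have fin: "finite {x :: bool list. length x = n}"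
    using finite_lists_length_eq[of "UNIV :: bool set" n] by simp
  then have finD: "finite (D t)" for t
    unfolding D_def by (rule rev_finite_subset) auto
  have anti: "D t' \<subseteq> D t" if "prefix t t'" for t t'
    unfolding D_def using that has_pattern_prefix by (auto elim!: eventually_mono)
  \<comment> \<open>Otherwise \<open>F\<close> would rule out each of the finitely many patterns,
    hence all of them at once, but every \<open>l\<close> admits some pattern.\<close>
  have ne: "D t \<noteq> {}" for t
  proof
    assume "D t = {}"
    then have "\<forall>x\<in>{x. length x = n}. eventually (\<lambda>l. \<not> has_pattern c t x l) F"
      using dec unfolding D_def by blast
    with fin have "eventually (\<lambda>l. \<forall>x\<in>{x. length x = n}. \<not> has_pattern c t x l) F"
      by (rule eventually_ball_finite)
    then have "eventually (\<lambda>l. False) F"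
      by (rule eventually_mono) (use has_pattern_exists in blast)
    then show False using F by (simp add: eventually_False)
  qed
  \<comment> \<open>Least cardinality together with \<open>anti\<close> forces \<open>D\<close> to
    be constant above \<open>t'\<close>.\<close>
  obtain t' where t': "prefix t t'" "\<And>u. prefix t u \<Longrightarrow> card (D t') \<le> card (D u)"
    using ex_has_least_nat[of "prefix t" t "\<lambda>u. card (D u)"] by auto
  have stable: "D u = D t'" if "prefix t' u" for u
    using that t' anti finD by (meson card_seteq prefix_order.trans)
  obtain x where x: "x \<in> D t'" using ne by blast
  have len: "length x = n" using x by (simp add: D_def)
  have dense: "dense_offsets c F i t' {k \<in> K. x ! k = i}" for i
    unfolding dense_offsets_def
  proof (intro allI impI)
    fix u assume "prefix t' u"
    then have "eventually (has_pattern c u x) F"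
      using x stable by (auto simp: D_def)
    then show "eventually (realizes c i u {k \<in> K. x ! k = i}) F"
    proof (rule eventually_mono)
      fix l assume "has_pattern c u x l"
      then obtain b where b: "prefix u b" "l + n \<le> length b" "\<forall>k<n. c (take (l + k) b) = x ! k"
        unfolding has_pattern_def len by blast
      have "\<forall>k\<in>{k \<in> K. x ! k = i}. l + k \<le> length b \<and> c (take (l + k) b) = i"
        using b n by fastforce
      then show "realizes c i u {k \<in> K. x ! k = i} l"
        unfolding realizes_def using b(1) by blast
    qed
  qed
  have "K - {k \<in> K. x ! k = True} = {k \<in> K. x ! k = False}" by auto
  then have "dense_offsets c F False t' (K - {k \<in> K. x ! k = True})"
    using dense[of False] by simp
  moreover have "{k \<in> K. x ! k = True} \<subseteq> K" by auto
  ultimately show ?thesis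
    using t'(1) dense[of True] by metis
qed

section \<open>Offset sets shared by finitely many nodes\<close>

definition common_offsets ::
  "(bool list \<Rightarrow> nat set \<Rightarrow> bool) \<Rightarrow> bool list set \<Rightarrow> nat \<Rightarrow> bool" where
  "common_offsets G T k \<longleftrightarrow>
     (\<exists>K f. finite K \<and> card K = k \<and> (\<forall>t\<in>T. prefix t (f t) \<and> G (f t) K))"

text \<open>Stated for an arbitrary \<open>G\<close>, because the argument uses only heredity in the
  offset set and the splitting of each finite set above a node.\<close>

lemma common_offsets_dichotomy:
  fixes G :: "bool \<Rightarrow> bool list \<Rightarrow> nat set \<Rightarrow> bool"
  assumes sub: "\<And>i t K K'. G i t K \<Longrightarrow> K' \<subseteq> K \<Longrightarrow> G i t K'"
    and part: "\<And>t K. finite K \<Longrightarrow>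
      \<exists>t' K0. prefix t t' \<and> K0 \<subseteq> K \<and> G True t' K0 \<and> G False t' (K - K0)"
  shows "\<exists>i s. \<forall>T k. finite T \<longrightarrow> (\<forall>t\<in>T. prefix s t) \<longrightarrow> common_offsets (G i) T k"
proof (cases "\<forall>T k. finite T \<longrightarrow> common_offsets (G True) T k")
  case True
  then show ?thesis by blast
next
  case False
  define bad where "bad T \<longleftrightarrow> finite T \<and> (\<exists>k. \<not> common_offsets (G True) T k)" for T
  have "\<exists>T. bad T" using False unfolding bad_def by blast
  then obtain T where "bad T" and least: "\<And>T'. bad T' \<Longrightarrow> card T \<le> card T'"
    using ex_has_least_nat[of bad _ card] by metis
  then have T: "finite T" "\<exists>k. \<not> common_offsets (G True) T k"
    by (simp_all add: bad_def)
  from T(2) obtain k where k: "\<not> common_offsets (G True) T k" by blast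
  \<comment> \<open>The empty family shares any offsets vacuously, so a failing family has a member
    to remove.\<close>
  have "T \<noteq> {}"
  proof
    assume "T = {}"
    then have "common_offsets (G True) T k"
      unfolding common_offsets_def by (intro exI[of _ "{..<k}"]) auto
    then show False using k by blast
  qed
  then obtain u where u: "u \<in> T" by blast
  have co: "common_offsets (G True) (T - {u}) N" for N
    using least[of "T - {u}"] T(1) u card_Diff1_less[OF T(1) u] by (auto simp: bad_def)
  \<comment> \<open>If the \<open>True\<close> part \<open>L\<close> had \<open>k\<close> points,
    redirecting \<open>f\<close> at \<open>u\<close> to \<open>t'\<close> would give all of
    \<open>T\<close> a shared set of size \<open>k\<close>. The set \<open>K\<close> is fixed before
    \<open>t\<close>, which lets it serve a whole family above \<open>u\<close>.\<close>
  have large: "\<exists>K. finite K \<and> card K = N \<and>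
      (\<forall>t. prefix u t \<longrightarrow> (\<exists>t' L. prefix t t' \<and> L \<subseteq> K \<and> card L < k \<and> G False t' (K - L)))" for N
  proof -
    obtain K f where K: "finite K" "card K = N"
      and f: "\<forall>t\<in>T - {u}. prefix t (f t) \<and> G True (f t) K"
      using co[of N] unfolding common_offsets_def by blast
    have "\<exists>t' L. prefix t t' \<and> L \<subseteq> K \<and> card L < k \<and> G False t' (K - L)" if t: "prefix u t" for t
    proof -
      obtain t' L where t': "prefix t t'" "L \<subseteq> K" "G True t' L" "G False t' (K - L)"
        using part[OF K(1)] by blast
      have "card L < k"
      proof (rule ccontr)
        assume "\<not> card L < k"
        then obtain L' where L': "L' \<subseteq> L" "card L' = k" "finite L'"
          using obtain_subset_with_card_n[of k L] by (metis not_less)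
        let ?g = "f(u := t')"
        have "prefix v (?g v) \<and> G True (?g v) L'" if "v \<in> T" for v
        proof (cases "v = u")
          case True
          then show ?thesis using t t' L' sub prefix_order.trans by auto
        next
          case False
          then show ?thesis using f that L' t'(2) sub[of True "f v" K L'] by auto
        qed
        then have "common_offsets (G True) T k"
          unfolding common_offsets_def using L' by blast
        then show False using k by blast
      qed
      then show ?thesis using t' by blast
    qed
    then show ?thesis using K by (intro exI[of _ K]) simp
  qed
  have "common_offsets (G False) S m" if S: "finite S" "\<forall>t\<in>S. prefix u t" for S m
  proof -
    \<comment> \<open>Each member of \<open>S\<close> discards fewer than \<open>k\<close> points,
      so \<open>card S * k\<close> points cover all losses and at least \<open>m\<close>
      remain.\<close>
    obtain K where K: "finite K" "card K = card S * k + m"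
      and dense: "\<forall>t. prefix u t \<longrightarrow>
        (\<exists>t' L. prefix t t' \<and> L \<subseteq> K \<and> card L < k \<and> G False t' (K - L))"
      using large[of "card S * k + m"] by auto
    have "\<forall>t\<in>S. \<exists>t' L. prefix t t' \<and> L \<subseteq> K \<and> card L < k \<and> G False t' (K - L)"
      using S(2) dense by simp
    then obtain f L where
      fL: "\<forall>t\<in>S. prefix t (f t) \<and> L t \<subseteq> K \<and> card (L t) < k \<and> G False (f t) (K - L t)"
      by metis
    have "card (\<Union>t\<in>S. L t) \<le> (\<Sum>t\<in>S. card (L t))"
      using S(1) by (rule card_UN_le)
    also have "\<dots> \<le> card S * k"
      using sum_bounded_above[of S "\<lambda>t. card (L t)" k] fL by (simp add: less_imp_le)
    finally have "card (\<Union>t\<in>S. L t) \<le> card S * k" .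
    moreover have "card K - card (\<Union>t\<in>S. L t) \<le> card (K - (\<Union>t\<in>S. L t))"
      using fL K(1) S(1) finite_subset by (intro diff_card_le_card_Diff) blast
    ultimately have "m \<le> card (K - (\<Union>t\<in>S. L t))"
      using K(2) by linarith
    then obtain K' where K': "K' \<subseteq> K - (\<Union>t\<in>S. L t)" "card K' = m" "finite K'"
      using obtain_subset_with_card_n by metis
    have "\<forall>t\<in>S. prefix t (f t) \<and> G False (f t) K'"
    proof
      fix t assume t: "t \<in> S"
      then have "K' \<subseteq> K - L t" using K' by blast
      then show "prefix t (f t) \<and> G False (f t) K'" using fL t sub by blast
    qed
    then show ?thesis unfolding common_offsets_def using K' by blast
  qed
  then show ?thesis by blast
qed

section \<open>Fusion\<close>

text \<open>The bound on \<open>a\<close> makes \<open>take a t\<close> the actual node at level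
  \<open>a\<close>, so colours already fixed are inherited by extensions.\<close>

definition levels_coloured :: "(bool list \<Rightarrow> bool) \<Rightarrow> bool \<Rightarrow> bool list set \<Rightarrow> nat set \<Rightarrow> bool" where
  "levels_coloured c i T B \<longleftrightarrow> (\<forall>t\<in>T. \<forall>a\<in>B. a \<le> length t \<and> c (take a t) = i)"

lemma levels_coloured_extend:
  assumes "levels_coloured c i T B" "\<forall>t\<in>T'. \<exists>s\<in>T. prefix s t"
  shows "levels_coloured c i T' B"
proof -
  have "a \<le> length t \<and> c (take a t) = i" if "t \<in> T'" "a \<in> B" for t a
  proof -
    obtain s where s: "s \<in> T" "prefix s t" using assms(2) \<open>t \<in> T'\<close> by blast
    then have "a \<le> length s" "c (take a s) = i"
      using assms(1) \<open>a \<in> B\<close> unfolding levels_coloured_def by blast+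
    then show ?thesis
      using s(2) by (auto simp: prefix_def)
  qed
  then show ?thesis unfolding levels_coloured_def by blast
qed

text \<open>The offset sets are handled one by one: density survives the extensions made for earlier
  sets. Finiteness of \<open>T\<close> lets \<open>F\<close> supply a single \<open>l\<close> for
  all nodes, as large as desired because \<open>F\<close> refines
  \<open>sequentially\<close>.\<close>

lemma realize_dense_offsets:
  assumes F: "F \<noteq> bot" "F \<le> sequentially" and T: "finite T"
    and Ks: "finite Ks" "\<forall>K\<in>Ks. \<forall>t\<in>T. dense_offsets c F i t K"
  shows "\<exists>f B. (\<forall>t\<in>T. prefix t (f t)) \<and> levels_coloured c i (f ` T) B \<and>
    (\<forall>K\<in>Ks. \<exists>l\<ge>n. \<forall>k\<in>K. l + k \<in> B)"
  using Ks
proof (induction Ks rule: finite_induct)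
  case empty
  show ?case
    by (rule exI[of _ id], rule exI[of _ "{}"]) (auto simp: levels_coloured_def)
next
  case (insert K Ks)
  then obtain f B where fB: "\<forall>t\<in>T. prefix t (f t)" "levels_coloured c i (f ` T) B"
    "\<forall>K\<in>Ks. \<exists>l\<ge>n. \<forall>k\<in>K. l + k \<in> B"
    by blast
  have "\<forall>t\<in>T. eventually (realizes c i (f t) K) F"
    using insert.prems fB(1) unfolding dense_offsets_def by blast
  then have "eventually (\<lambda>l. \<forall>t\<in>T. realizes c i (f t) K l) F"
    using T by (simp add: eventually_ball_finite)
  moreover have "eventually (\<lambda>l. n \<le> l) F"
    using F(2) eventually_ge_at_top filter_leD by blast
  ultimately have "eventually (\<lambda>l. (\<forall>t\<in>T. realizes c i (f t) K l) \<and> n \<le> l) F"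
    by (rule eventually_conj)
  then obtain l where l: "\<forall>t\<in>T. realizes c i (f t) K l" "n \<le> l"
    using F(1) eventually_happens' by blast
  then obtain g where g: "\<forall>t\<in>T. prefix (f t) (g t) \<and>
      (\<forall>k\<in>K. l + k \<le> length (g t) \<and> c (take (l + k) (g t)) = i)"
    unfolding realizes_def by metis
  have "levels_coloured c i (g ` T) B"
    using fB(2) by (rule levels_coloured_extend) (use g in blast)
  then have "levels_coloured c i (g ` T) (B \<union> (\<lambda>k. l + k) ` K)"
    using g unfolding levels_coloured_def by auto
  moreover have "\<forall>t\<in>T. prefix t (g t)"
    using fB(1) g prefix_order.trans by blast
  moreover have "\<forall>K'\<in>insert K Ks. \<exists>l'\<ge>n. \<forall>k\<in>K'. l' + k \<in> B \<union> (\<lambda>k. l + k) ` K"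
  proof
    fix K' assume "K' \<in> insert K Ks"
    then show "\<exists>l'\<ge>n. \<forall>k\<in>K'. l' + k \<in> B \<union> (\<lambda>k. l + k) ` K"
    proof
      assume "K' = K"
      then show ?thesis using l(2) by (intro exI[of _ l]) simp
    next
      assume "K' \<in> Ks"
      then show ?thesis using fB(3) by (meson UnI1)
    qed
  qed
  ultimately show ?case by (intro exI[of _ g] exI[of _ "B \<union> (\<lambda>k. l + k) ` K"] conjI)
qed

text \<open>\<open>T\<close> is the current front of the tree, \<open>Ks\<close> holds the offset
  sets to be translated again at every later stage, and \<open>B\<close> the levels whose colour is
  already fixed.\<close>

definition fusion_stage ::
  "(bool list \<Rightarrow> bool) \<Rightarrow> nat filter \<Rightarrow> bool \<Rightarrow> bool list \<Rightarrow>
   bool list set \<times> nat set set \<times> nat set \<Rightarrow> bool" where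
  "fusion_stage c F i s = (\<lambda>(T, Ks, B).
     finite T \<and> T \<noteq> {} \<and> (\<forall>t\<in>T. prefix s t) \<and> finite Ks \<and>
     (\<forall>K\<in>Ks. \<forall>t\<in>T. dense_offsets c F i t K) \<and> levels_coloured c i T B)"

definition fusion_step ::
  "nat \<Rightarrow> bool list set \<times> nat set set \<times> nat set \<Rightarrow>
   bool list set \<times> nat set set \<times> nat set \<Rightarrow> bool" where
  "fusion_step n = (\<lambda>(T, Ks, B) (T', Ks', B').
     (\<forall>t\<in>T. \<exists>u\<in>T'. \<exists>v\<in>T'. prefix t u \<and> prefix t v \<and> u \<parallel> v) \<and>
     Ks \<subseteq> Ks' \<and> (\<exists>K\<in>Ks'. finite K \<and> card K = n) \<and>
     B \<subseteq> B' \<and> (\<forall>K\<in>Ks'. \<exists>l\<ge>n. \<forall>k\<in>K. l + k \<in> B'))"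

text \<open>The nodes are extended three times: to split, to share a new offset set, and to realize
  every pending offset set.\<close>

lemma fusion_step_exists:
  assumes F: "F \<noteq> bot" "F \<le> sequentially"
    and common: "\<And>T k. finite T \<Longrightarrow> \<forall>t\<in>T. prefix s t \<Longrightarrow> common_offsets (dense_offsets c F i) T k"
    and stage: "fusion_stage c F i s (T, Ks, B)"
  shows "\<exists>S. fusion_stage c F i s S \<and> fusion_step n (T, Ks, B) S"
proof -
  have st: "finite T" "T \<noteq> {}" "\<forall>t\<in>T. prefix s t" "finite Ks"
    "\<forall>K\<in>Ks. \<forall>t\<in>T. dense_offsets c F i t K" "levels_coloured c i T B"
    using stage by (simp_all add: fusion_stage_def)
  \<comment> \<open>Splitting comes first, so that both children share the new \<open>K\<close> and
    are coloured on the same levels.\<close>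
  define T1 where "T1 = (\<Union>t\<in>T. {t @ [True], t @ [False]})"
  have T1: "finite T1" "T1 \<noteq> {}" "\<forall>t\<in>T1. prefix s t" "\<forall>t\<in>T1. \<exists>u\<in>T. prefix u t"
    using st by (auto simp: T1_def)
  obtain K f where K: "finite K" "card K = n"
    and f: "\<forall>t\<in>T1. prefix t (f t) \<and> dense_offsets c F i (f t) K"
    using common[OF T1(1,3), of n] unfolding common_offsets_def by blast
  define Ks' where "Ks' = insert K Ks"
  have Ks': "finite Ks'" using st by (simp add: Ks'_def)
  have below: "\<forall>t\<in>T1. \<exists>u\<in>T. prefix u (f t)"
    using T1(4) f prefix_order.trans by blast
  have dense: "\<forall>K\<in>Ks'. \<forall>t\<in>f ` T1. dense_offsets c F i t K"
    unfolding Ks'_def using st f below dense_offsets_extend by blast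
  obtain g B1 where g: "\<forall>t\<in>f ` T1. prefix t (g t)" "levels_coloured c i (g ` f ` T1) B1"
    "\<forall>K\<in>Ks'. \<exists>l\<ge>n. \<forall>k\<in>K. l + k \<in> B1"
    using realize_dense_offsets[OF F _ Ks' dense, of n] T1(1) by blast
  define T' where "T' = g ` f ` T1"
  have ext: "prefix t (g (f t))" if "t \<in> T1" for t
    using that f g(1) prefix_order.trans by blast
  have dense': "\<forall>K\<in>Ks'. \<forall>t\<in>T'. dense_offsets c F i t K"
    unfolding T'_def using dense g(1) dense_offsets_extend by blast
  have "levels_coloured c i T' B"
  proof (rule levels_coloured_extend[OF st(6)])
    show "\<forall>t\<in>T'. \<exists>u\<in>T. prefix u t"
      unfolding T'_def using T1(4) ext prefix_order.trans by blast
  qed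
  then have lev: "levels_coloured c i T' (B \<union> B1)"
    using g(2) unfolding levels_coloured_def T'_def by blast
  have "\<forall>t\<in>T'. prefix s t"
    unfolding T'_def using T1(3) ext prefix_order.trans by blast
  then have new_stage: "fusion_stage c F i s (T', Ks', B \<union> B1)"
    using T1(1,2) Ks' dense' lev by (simp add: fusion_stage_def T'_def)
  have "\<exists>u\<in>T'. \<exists>v\<in>T'. prefix t u \<and> prefix t v \<and> u \<parallel> v" if "t \<in> T" for t
  proof -
    have in1: "t @ [True] \<in> T1" "t @ [False] \<in> T1"
      using that by (auto simp: T1_def)
    have "t @ [True] \<parallel> t @ [False]" by (simp add: parallel_def)
    then have "g (f (t @ [True])) \<parallel> g (f (t @ [False]))"
      using ext[OF in1(1)] ext[OF in1(2)] by (metis parallel_append prefix_def)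
    moreover have "prefix t (g (f (t @ [True])))" "prefix t (g (f (t @ [False])))"
      using ext[OF in1(1)] ext[OF in1(2)] by (meson append_prefixD)+
    ultimately show ?thesis
      using in1 unfolding T'_def by blast
  qed
  moreover have "\<exists>l\<ge>n. \<forall>k\<in>K'. l + k \<in> B \<union> B1" if "K' \<in> Ks'" for K'
    using g(3) that by (meson UnI2)
  ultimately have "fusion_step n (T, Ks, B) (T', Ks', B \<union> B1)"
    using K by (simp add: fusion_step_def Ks'_def subset_insertI)
  with new_stage show ?thesis by blast
qed

text \<open>Take the downward closure of the fronts and the union of the \<open>B n\<close>. Every
  front node has extensions in all later fronts, so a level added late still has the right colour on
  the whole tree.\<close>

lemma fusion:
  assumes stage: "\<And>n. fusion_stage c F i s (T n, Ks n, B n)"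
    and step: "\<And>n. fusion_step n (T n, Ks n, B n) (T (Suc n), Ks (Suc n), B (Suc n))"
  shows "\<exists>p\<in>perfect_trees. \<exists>A. translate_positive A \<and> (\<forall>s\<in>tree_restrict p A. c s = i)"
proof -
  define p where "p = {u. \<exists>n. \<exists>t\<in>T n. prefix u t}"
  define A where "A = (\<Union>n. B n)"
  have nonempty: "T n \<noteq> {}" and coloured: "levels_coloured c i (T n) (B n)" for n
    using stage[of n] by (simp_all add: fusion_stage_def)
  have splitT: "\<forall>t\<in>T n. \<exists>u\<in>T (Suc n). \<exists>v\<in>T (Suc n). prefix t u \<and> prefix t v \<and> u \<parallel> v"
    and SucK: "Ks n \<subseteq> Ks (Suc n)" and newK: "\<exists>K\<in>Ks (Suc n). finite K \<and> card K = n"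
    and SucB: "B n \<subseteq> B (Suc n)"
    and visit: "\<forall>K\<in>Ks (Suc n). \<exists>l\<ge>n. \<forall>k\<in>K. l + k \<in> B (Suc n)" for n
    using step[of n] by (simp_all add: fusion_step_def)
  have Tp: "t \<in> p" if "t \<in> T n" for t n
    using that by (auto simp: p_def)
  have split: "\<exists>t\<in>p. \<exists>v\<in>p. prefix u t \<and> prefix u v \<and> t \<parallel> v" if "u \<in> p" for u
  proof -
    obtain n t where "t \<in> T n" "prefix u t" using \<open>u \<in> p\<close> by (auto simp: p_def)
    moreover from this splitT[of n] obtain v w
      where "v \<in> T (Suc n)" "w \<in> T (Suc n)" "prefix t v" "prefix t w" "v \<parallel> w" by blast
    ultimately show ?thesis using Tp prefix_order.trans by blast
  qed
  have "is_tree p"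
    unfolding is_tree_def
  proof (intro conjI ballI allI impI)
    show "p \<noteq> {}" using nonempty[of 0] Tp by blast
    show "v \<in> p" if "t \<in> p" "prefix v t" for v t
      using that prefix_order.trans unfolding p_def by blast
    show "\<exists>t\<in>p. strict_prefix u t" if "u \<in> p" for u
      using split[OF that] by (metis parallelE prefix_order.le_less)
  qed
  then have "p \<in> perfect_trees"
    using split by (simp add: perfect_trees_def)
  have monoB: "B m \<subseteq> B n" if "m \<le> n" for m n
    by (rule lift_Suc_mono_le[of B, OF SucB that])
  have monoK: "Ks m \<subseteq> Ks n" if "m \<le> n" for m n
    by (rule lift_Suc_mono_le[of Ks, OF SucK that])
  have above: "\<exists>v\<in>T n. prefix t v" if "t \<in> T m" "m \<le> n" for t m n
    using that(2)
  proof (induction n rule: dec_induct)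
    case base
    then show ?case using that(1) by blast
  next
    case (step n)
    then show ?case using splitT[of n] prefix_order.trans by blast
  qed
  have "c u = i" if u: "u \<in> tree_restrict p A" for u
  proof -
    \<comment> \<open>The front extending \<open>u\<close> and the stage fixing level
      \<open>length u\<close> may differ; at \<open>max m n\<close> both are available, and
      \<open>u\<close> is an initial segment of \<open>v\<close>.\<close>
    obtain m n t where "t \<in> T m" "prefix u t" "length u \<in> B n"
      using u by (auto simp: tree_restrict_def p_def A_def)
    moreover obtain v where v: "v \<in> T (max m n)" "prefix t v"
      using above[OF \<open>t \<in> T m\<close>, of "max m n"] by auto
    ultimately have "prefix u v" "length u \<in> B (max m n)"
      using prefix_order.trans monoB[of n "max m n"] by auto
    then have "c (take (length u) v) = i"
      using coloured[of "max m n"] v(1) unfolding levels_coloured_def by blast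
    then show "c u = i"
      using \<open>prefix u v\<close> by (auto simp: prefix_def)
  qed
  moreover have "translate_positive A"
    unfolding translate_positive_def
  proof
    fix k
    obtain K where K: "K \<in> Ks (Suc k)" "finite K" "card K = k"
      using newK[of k] by blast
    have "\<exists>l\<ge>n. l \<in> {l. \<forall>x\<in>K. l + x \<in> A}" for n
    proof -
      \<comment> \<open>The maximum serves two ends: the stage is late enough to contain
        \<open>K\<close>, and the translate is at least the given \<open>n\<close>.\<close>
      have "K \<in> Ks (Suc (max n k))"
        using K(1) monoK[of "Suc k" "Suc (max n k)"] by auto
      then obtain l where "l \<ge> max n k" "\<forall>x\<in>K. l + x \<in> B (Suc (max n k))"
        using visit[of "max n k"] by blast
      then show ?thesis by (intro exI[of _ l]) (auto simp: A_def)
    qed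
    then have "infinite {l. \<forall>x\<in>K. l + x \<in> A}"
      unfolding infinite_nat_iff_unbounded_le by blast
    then show "\<exists>K. finite K \<and> card K = k \<and> infinite {l. \<forall>x\<in>K. l + x \<in> A}"
      using K by blast
  qed
  ultimately show ?thesis using \<open>p \<in> perfect_trees\<close> by blast
qed

section \<open>Homogeneous perfect trees and the HL property\<close>

lemma homogeneous_perfect_tree:
  fixes c :: "bool list \<Rightarrow> bool"
  shows "\<exists>p\<in>perfect_trees. \<exists>A. translate_positive A \<and> (\<exists>i. \<forall>s\<in>tree_restrict p A. c s = i)"
proof -
  obtain F where F: "F \<noteq> bot" "F \<le> sequentially" and
    dec: "\<And>a. eventually ((\<lambda>(t, x). has_pattern c t x) a) F \<or>
      eventually (\<lambda>l. \<not> (\<lambda>(t, x). has_pattern c t x) a l) F"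
    using deciding_filter_exists[of "\<lambda>(t, x). has_pattern c t x"] by blast
  have dec': "eventually (has_pattern c t x) F \<or> eventually (\<lambda>l. \<not> has_pattern c t x l) F" for t x
    using dec[of "(t, x)"] by simp
  have "\<exists>i s. \<forall>T k. finite T \<longrightarrow> (\<forall>t\<in>T. prefix s t) \<longrightarrow>
      common_offsets (dense_offsets c F i) T k"
  proof (rule common_offsets_dichotomy)
    show "dense_offsets c F i t K'" if "dense_offsets c F i t K" "K' \<subseteq> K" for i t K K'
      using that by (rule dense_offsets_subset)
    show "\<exists>t' K0. prefix t t' \<and> K0 \<subseteq> K \<and> dense_offsets c F True t' K0
        \<and> dense_offsets c F False t' (K - K0)" if "finite K" for t K
      using F(1) dec' that by (rule dense_offsets_partition)
  qed
  then obtain i s where common: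
    "\<And>T k. finite T \<Longrightarrow> \<forall>t\<in>T. prefix s t \<Longrightarrow> common_offsets (dense_offsets c F i) T k"
    by blast
  \<comment> \<open>Fusion starts at the node \<open>s\<close> above which finite families share
    offsets, with no offset sets or levels yet.\<close>
  have init: "fusion_stage c F i s ({s}, {}, {})"
    by (simp add: fusion_stage_def levels_coloured_def)
  have "\<exists>S. \<forall>n. fusion_stage c F i s (S n) \<and> fusion_step n (S n) (S (Suc n))"
  proof (rule dependent_nat_choice)
    show "\<exists>S. fusion_stage c F i s S" using init by blast
    fix S n assume "fusion_stage c F i s S"
    then show "\<exists>S'. fusion_stage c F i s S' \<and> fusion_step n S S'"
      using fusion_step_exists[OF F common] by (cases S) blast
  qed
  then obtain S where S: "\<And>n. fusion_stage c F i s (S n)" "\<And>n. fusion_step n (S n) (S (Suc n))"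
    by blast
  have "\<exists>p\<in>perfect_trees. \<exists>A. translate_positive A \<and> (\<forall>s\<in>tree_restrict p A. c s = i)"
    by (rule fusion[of c F i s "\<lambda>n. fst (S n)" "\<lambda>n. fst (snd (S n))" "\<lambda>n. snd (snd (S n))"])
      (use S in simp_all)
  then show ?thesis by blast
qed

theorem theorem3p12:
  shows "HL_ideal SC"
proof -
  have "\<exists>p\<in>perfect_trees. \<exists>A. A \<notin> SC \<and> (\<exists>i. \<forall>s\<in>tree_restrict p A. c s = i)"
    for c :: "bool list \<Rightarrow> bool"
  proof -
    obtain p A i where "p \<in> perfect_trees" "translate_positive A" "\<forall>s\<in>tree_restrict p A. c s = i"
      using homogeneous_perfect_tree[of c] by auto
    moreover from this have "A \<notin> SC" using SC_subset by auto
    ultimately show ?thesis by metis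
  qed
  then show ?thesis using ideal_SC by (simp add: HL_ideal_def)
qed

end
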